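(* Let $K,L\in\mathcal{K}^n$, let $i$ be an integer with $0\le i<n$, and let $\phi\in\Phi_2$. Then $$1\ge\phi\left(\left(\frac{A_i(K)}{A_i(K+_\phi L)}\right)^{1/(n-i)},\left(\frac{A_i(L)}{A_i(K+_\phi L)}\right)^{1/(n-i)}\right).$$ If $\phi$ is strictly convex, equality holds if and only if $K$ and $L$ have similar width.
   Context: $\mathcal{K}^n$ is the class of convex bodies (compact convex sets with nonempty interior) in $\mathbb{R}^n$ containing the origin in their interiors. The support function is $h(K,x)=\max\{x\cdot y:y\in K\}$, and the half width of $K$ in direction $u\in S^{n-1}$ is $b(K,u)=\frac12(h(K,u)+h(K,-u))$. $K$ and $L$ have similar width if there is a constant $\lambda>0$ with $b(K,u)=\lambda b(L,u)$ for all $u\in S^{n-1}$. $dS$ is the surface area measure on the unit sphere $S^{n-1}$. For an integer $0\le i<n$ the width integral is $A_i(K)=\frac1n\int_{S^{n-1}}b(K,u)^{n-i}\,dS(u)$. $\Phi_2$ is the set of convex functions $\phi$ on $[0,\infty)^2$, with values in $(0,\infty)$ on $(0,\infty)^2$, that are strictly decreasing in each variable and satisfy $\phi(0,0)=\infty$ and $\phi(\infty,1)=\phi(1,\infty)=1$ (values involving $0$ or $\infty$ are understood as limits). For $K,L\in\mathcal{K}^n$ and $\phi\in\Phi_2$, the Orlicz width addition $K+_\phi L$ is defined through its half width function: for every $u\in S^{n-1}$, $b(K+_\phi L,u)$ is the positive number satisfying $$\phi\left(\frac{b(K,u)}{b(K+_\phi L,u)},\frac{b(L,u)}{b(K+_\phi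 L,u)}\right)=1$$ (the definition presupposes that this equation has a solution, which is then unique by monotonicity). The quantity $A_i(K+_\phi L)$ is $\frac1n\int_{S^{n-1}}b(K+_\phi L,u)^{n-i}\,dS(u)$. *)

theory Defs
  imports "HOL-Analysis.Analysis"
begin

section \<open>Convex bodies and their widths\<close>

definition convex_bodies_o :: "(real^'n) set set" where
  "convex_bodies_o = {K. compact K \<and> convex K \<and> 0 \<in> interior K}"

definition support_fun :: "(real^'n) set \<Rightarrow> real^'n \<Rightarrow> real" where
  "support_fun K x = (SUP y\<in>K. x \<bullet> y)"

lemma support_fun_is_max:
  fixes K :: "(real^'n) set"
  assumes "compact K" "K \<noteq> {}"
  shows "\<exists>y\<in>K. support_fun K x = x \<bullet> y \<and> (\<forall>z\<in>K. x \<bullet> z \<le> x \<bullet> y)"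
proof -
  have "continuous_on K (\<lambda>y. x \<bullet> y)" by (intro continuous_intros)
  then obtain y where y: "y \<in> K" "\<forall>z\<in>K. x \<bullet> z \<le> x \<bullet> y"
    using continuous_attains_sup[OF assms] by blast
  then have "(SUP y\<in>K. x \<bullet> y) = x \<bullet> y"
    by (intro cSup_eq_maximum) auto
  with y show ?thesis unfolding support_fun_def by blast
qed

definition half_width :: "(real^'n) set \<Rightarrow> real^'n \<Rightarrow> real" where
  "half_width K u = (support_fun K u + support_fun K (- u)) / 2"

definition similar_width :: "(real^'n) set \<Rightarrow> (real^'n) set \<Rightarrow> bool" where
  "similar_width K L \<longleftrightarrow>
     (\<exists>c>0. \<forall>u\<in>sphere 0 1. half_width K u = c * half_width L u)"

section \<open>Surface area measure on the unit sphere\<close>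

text \<open>
  The measure of a Borel set \<open>A\<close> of unit vectors is \<open>n\<close> times the volume of the cone
  \<open>{t u | u \<in> A, 0 < t \<le> 1}\<close>. It is obtained by pushing Lebesgue measure on the punctured unit
  ball forward along the radial projection. For \<open>n = 1\<close> it is counting measure on the two
  unit vectors.
\<close>

definition sphere_measure :: "(real^'n) measure" where
  "sphere_measure =
     scale_measure (of_nat CARD('n))
       (distr (restrict_space lborel (cball 0 1 - {0})) (restrict_space borel (sphere 0 1))
          (\<lambda>x. x /\<^sub>R norm x))"

lemma space_sphere_measure: "space (sphere_measure :: (real^'n) measure) = sphere 0 1"
  by (simp add: sphere_measure_def space_scale_measure space_restrict_space)

lemma sets_sphere_measure:
  "sets (sphere_measure :: (real^'n) measure) = sets (restrict_space borel (sphere 0 1))"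
  by (simp add: sphere_measure_def)

lemma emeasure_sphere_measure:
  fixes A :: "(real^'n) set"
  assumes "A \<in> sets borel" "A \<subseteq> sphere 0 1"
  shows "emeasure sphere_measure A
    = of_nat CARD('n) * emeasure lborel {t *\<^sub>R u | t u. 0 < t \<and> t \<le> 1 \<and> u \<in> A}"
proof -
  let ?B = "cball 0 1 - {0} :: (real^'n) set"
  let ?p = "\<lambda>x::real^'n. x /\<^sub>R norm x"
  have "?p \<in> borel_measurable (restrict_space lborel ?B)"
    by (intro measurable_restrict_space1) measurable
  then have p: "?p \<in> measurable (restrict_space lborel ?B) (restrict_space borel (sphere 0 1))"
    by (intro measurable_restrict_space2) (auto simp: space_restrict_space)
  have A: "A \<in> sets (restrict_space borel (sphere 0 1))"
    using assms by (auto simp: sets_restrict_space)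
  have eq: "?p -` A \<inter> ?B = {t *\<^sub>R u | t u. 0 < t \<and> t \<le> 1 \<and> u \<in> A}" (is "?L = ?R")
  proof
    show "?L \<subseteq> ?R"
    proof
      fix x assume "x \<in> ?L"
      then have "x = norm x *\<^sub>R ?p x" "0 < norm x" "norm x \<le> 1" "?p x \<in> A" by auto
      then show "x \<in> ?R" by blast
    qed
    show "?R \<subseteq> ?L"
    proof
      fix x assume "x \<in> ?R"
      then obtain t u where x: "x = t *\<^sub>R u" "0 < t" "t \<le> 1" "u \<in> A" by blast
      moreover have "norm u = 1" using x assms(2) by auto
      ultimately have "norm x = t" "u \<noteq> 0" by auto
      with x show "x \<in> ?L" by auto
    qed
  qed
  have "emeasure (distr (restrict_space lborel ?B) (restrict_space borel (sphere 0 1)) ?p) A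
      = emeasure (restrict_space lborel ?B) (?p -` A \<inter> ?B)"
    using emeasure_distr[OF p A] by (simp add: space_restrict_space)
  also have "\<dots> = emeasure lborel (?p -` A \<inter> ?B)"
    by (intro emeasure_restrict_space) auto
  finally show ?thesis
    by (simp add: sphere_measure_def eq)
qed

section \<open>Width integrals\<close>

text \<open>
  Width integrals depend on a body only through its half width function \<open>b\<close>. Since
  \<open>K +\<^sub>\<phi> L\<close> is given only by such a function, they are defined for functions first.
\<close>

definition width_integral_of :: "nat \<Rightarrow> (real^'n \<Rightarrow> real) \<Rightarrow> real" where
  "width_integral_of i b =
     1 / real CARD('n) * (LINT u|sphere_measure. b u ^ (CARD('n) - i))"

definition width_integral :: "nat \<Rightarrow> (real^'n) set \<Rightarrow> real" where
  "width_integral i K = width_integral_of i (half_width K)"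

section \<open>Orlicz width addition\<close>

abbreviation pos_quadrant :: "(real \<times> real) set" where
  "pos_quadrant \<equiv> {0<..} \<times> {0<..}"

text \<open>
  Only the values of \<open>\<phi>\<close> on the open quadrant carry information: a value at a point with a
  coordinate \<open>0\<close> or \<open>\<infinity>\<close> is by convention a limit of these, and may be infinite. Hence \<open>\<phi>\<close> is a
  real function whose behaviour outside the open quadrant is irrelevant.
  The last three conditions say \<open>\<phi>(0,0) = \<infinity>\<close>, \<open>\<phi>(\<infinity>,1) = 1\<close> and \<open>\<phi>(1,\<infinity>) = 1\<close>.
\<close>

definition Phi2 :: "(real \<times> real \<Rightarrow> real) set" where
  "Phi2 = {\<phi>.
     convex_on pos_quadrant \<phi> \<and>
     (\<forall>p\<in>pos_quadrant. 0 < \<phi> p) \<and>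
     (\<forall>y>0. \<forall>x>0. \<forall>x'>x. \<phi> (x', y) < \<phi> (x, y)) \<and>
     (\<forall>x>0. \<forall>y>0. \<forall>y'>y. \<phi> (x, y') < \<phi> (x, y)) \<and>
     filterlim \<phi> at_top (at (0, 0) within pos_quadrant) \<and>
     ((\<lambda>x. \<phi> (x, 1)) \<longlongrightarrow> 1) at_top \<and>
     ((\<lambda>y. \<phi> (1, y)) \<longlongrightarrow> 1) at_top}"

definition strictly_convex_on :: "'a::real_vector set \<Rightarrow> ('a \<Rightarrow> real) \<Rightarrow> bool" where
  "strictly_convex_on S f \<longleftrightarrow> convex S \<and>
     (\<forall>x\<in>S. \<forall>y\<in>S. \<forall>t. x \<noteq> y \<longrightarrow> 0 < t \<longrightarrow> t < 1 \<longrightarrow>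
        f ((1 - t) *\<^sub>R x + t *\<^sub>R y) < (1 - t) * f x + t * f y)"

definition is_orlicz_half_width ::
  "(real \<times> real \<Rightarrow> real) \<Rightarrow> (real^'n) set \<Rightarrow> (real^'n) set \<Rightarrow> real^'n \<Rightarrow> real \<Rightarrow> bool" where
  "is_orlicz_half_width \<phi> K L u c \<longleftrightarrow>
     0 < c \<and> \<phi> (half_width K u / c, half_width L u / c) = 1"

text \<open>
  A solution need not exist (for \<open>\<phi>(x,y) = 1 + 1/(x y)\<close> it never does), so that
  \<open>K +\<^sub>\<phi> L\<close> is defined only under the following condition.
\<close>

definition orlicz_sum_defined ::
  "(real \<times> real \<Rightarrow> real) \<Rightarrow> (real^'n) set \<Rightarrow> (real^'n) set \<Rightarrow> bool" where
  "orlicz_sum_defined \<phi> K L \<longleftrightarrow> (\<forall>u\<in>sphere 0 1. \<exists>c. is_orlicz_half_width \<phi> K L u c)"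

definition orlicz_half_width ::
  "(real \<times> real \<Rightarrow> real) \<Rightarrow> (real^'n) set \<Rightarrow> (real^'n) set \<Rightarrow> real^'n \<Rightarrow> real" where
  "orlicz_half_width \<phi> K L u = (THE c. is_orlicz_half_width \<phi> K L u c)"

text \<open>The quantity \<open>A\<^sub>i(K +\<^sub>\<phi> L)\<close>.\<close>

definition orlicz_width_integral ::
  "nat \<Rightarrow> (real \<times> real \<Rightarrow> real) \<Rightarrow> (real^'n) set \<Rightarrow> (real^'n) set \<Rightarrow> real" where
  "orlicz_width_integral i \<phi> K L = width_integral_of i (orlicz_half_width \<phi> K L)"

end

theory Submission
  imports Defs "HOL-Probability.Probability_Measure"
begin

text \<open>
  Put \<open>p = n - i\<close>, let \<open>c\<close> be the half width function of \<open>K +\<^sub>\<phi> L\<close>, and let \<open>\<mu>\<close> be the probability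
  measure on the sphere with density proportional to \<open>c\<^sup>p\<close>. Since \<open>\<phi>(b\<^sub>K/c, b\<^sub>L/c) = 1\<close> everywhere,
  Jensen's inequality for \<open>\<phi>\<close> gives \<open>\<phi>(m) \<le> 1\<close>, where \<open>m\<close> is the \<open>\<mu>\<close>-mean of \<open>(b\<^sub>K/c, b\<^sub>L/c)\<close>. Passing
  from the means to the \<open>p\<close>-means, which are the arguments of \<open>\<phi>\<close> in the theorem, only
  increases the arguments and hence decreases \<open>\<phi>\<close>. Equality with strictly convex \<open>\<phi>\<close> forces
  \<open>(b\<^sub>K/c, b\<^sub>L/c)\<close> to be almost everywhere constant, so \<open>b\<^sub>K/b\<^sub>L\<close> is constant by continuity.
\<close>

section \<open>Jensen's inequality for sublevel sets\<close>

text \<open>An open subset of a closed half-space lies in its interior, which is the open half-space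
  because \<open>a\<close> is nonzero.\<close>

lemma halfspace_ge_open_strict:
  fixes a :: "'a::euclidean_space"
  assumes "open T" "a \<noteq> 0" "\<And>x. x \<in> T \<Longrightarrow> b \<le> a \<bullet> x" "x \<in> T"
  shows "b < a \<bullet> x"
proof -
  have "T \<subseteq> interior {x. a \<bullet> x \<ge> b}"
    using assms by (intro interior_maximal) auto
  with assms show ?thesis by (auto simp: interior_halfspace_ge)
qed

text \<open>Jensen's inequality in geometric form: the sublevel set of \<open>f\<close> at height
  \<open>r\<close> is convex, and the mean of a variable with values in it cannot lie strictly
  beyond a separating hyperplane. Arguing with the sublevel set keeps the integrability of
  \<open>f (Z \<omega>)\<close> out of the picture.\<close>

lemma (in prob_space) expectation_sublevel:
  fixes Z :: "'a \<Rightarrow> 'b::euclidean_space"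
  assumes Z: "integrable M Z" and U: "open U" and f: "convex_on U f"
    and EZ: "expectation Z \<in> U"
    and ZU: "\<And>\<omega>. \<omega> \<in> space M \<Longrightarrow> Z \<omega> \<in> U" and le: "\<And>\<omega>. \<omega> \<in> space M \<Longrightarrow> f (Z \<omega>) \<le> r"
  shows "f (expectation Z) \<le> r"
proof (rule ccontr)
  assume "\<not> f (expectation Z) \<le> r"
  then have gt: "r < f (expectation Z)" by simp
  have cont: "continuous_on U f" using convex_on_continuous[OF U f] .
  \<comment> \<open>Separating the mean alone from the sublevel set would give a weak inequality
    only. A ball around the mean on which \<open>f\<close> still exceeds \<open>r\<close> is
    separated instead, which makes the inequality strict at its centre.\<close>
  have "open (U \<inter> f -` {r<..})"
    using continuous_open_preimage[OF cont U] by simp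
  then obtain e where e: "e > 0" "ball (expectation Z) e \<subseteq> U \<inter> f -` {r<..}"
    using EZ gt by (force simp: open_contains_ball)
  define S where "S = {x\<in>U. f x \<le> r}"
  have "convex S"
  proof (rule convexI)
    fix x y and u v :: real assume xy: "x \<in> S" "y \<in> S" "0 \<le> u" "0 \<le> v" "u + v = 1"
    have "f (u *\<^sub>R x + v *\<^sub>R y) \<le> u * f x + v * f y"
      using f xy by (auto simp: convex_on_def S_def)
    also have "\<dots> \<le> u * r + v * r"
      using xy by (intro add_mono mult_left_mono) (auto simp: S_def)
    also have "\<dots> = r" using xy by (simp flip: distrib_right)
    finally show "u *\<^sub>R x + v *\<^sub>R y \<in> S"
      using xy f by (auto simp: S_def convex_on_def convex_def)
  qed
  moreover have ZS: "Z \<omega> \<in> S" if "\<omega> \<in> space M" for \<omega>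
    using that ZU le by (auto simp: S_def)
  then have "S \<noteq> {}" using not_empty by blast
  moreover have "S \<inter> ball (expectation Z) e = {}" using e(2) by (auto simp: S_def)
  ultimately obtain a b where ab: "a \<noteq> 0" "\<forall>x\<in>S. a \<bullet> x \<le> b" "\<forall>x\<in>ball (expectation Z) e. b \<le> a \<bullet> x"
    using separating_hyperplane_sets[of S "ball (expectation Z) e"] e(1) by auto
  have "b < a \<bullet> expectation Z"
    using ab e(1) by (intro halfspace_ge_open_strict[of "ball (expectation Z) e"]) auto
  also have "\<dots> = expectation (\<lambda>\<omega>. a \<bullet> Z \<omega>)"
    using Z by simp
  also have "\<dots> \<le> expectation (\<lambda>_. b)"
    using Z ab(2) ZS by (intro integral_mono) auto
  finally show False by (simp add: prob_space)
qed

text \<open>Strict convexity pushes the midpoint of the mean and any other value of \<open>Z\<close>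
  into the open convex set \<open>{f < r}\<close>. A hyperplane separating the mean from that set
  then has all those values strictly on one side, whereas
  \<open>a \<bullet> Z \<omega> - a \<bullet> ?m\<close> integrates to zero.\<close>

lemma (in prob_space) strictly_convex_expectation_sublevel:
  fixes Z :: "'a \<Rightarrow> 'b::euclidean_space"
  assumes Z: "integrable M Z" and U: "open U" and f: "convex_on U f" "strictly_convex_on U f"
    and EZ: "expectation Z \<in> U" "r \<le> f (expectation Z)"
    and ZU: "\<And>\<omega>. \<omega> \<in> space M \<Longrightarrow> Z \<omega> \<in> U" and le: "\<And>\<omega>. \<omega> \<in> space M \<Longrightarrow> f (Z \<omega>) \<le> r"
  shows "AE \<omega> in M. Z \<omega> = expectation Z"
proof -
  let ?m = "expectation Z"
  have "f ?m \<le> r"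
    using expectation_sublevel[OF Z U f(1) EZ(1) ZU le] by blast
  with EZ have fm: "f ?m = r" by simp
  define T where "T = {x\<in>U. f x < r}"
  have mid: "(1/2) *\<^sub>R ?m + (1/2) *\<^sub>R Z \<omega> \<in> T" if "\<omega> \<in> space M" "Z \<omega> \<noteq> ?m" for \<omega>
  proof -
    have "f ((1 - 1/2) *\<^sub>R ?m + (1/2) *\<^sub>R Z \<omega>) < (1 - 1/2) * f ?m + (1/2) * f (Z \<omega>)"
      using f(2)[unfolded strictly_convex_on_def, THEN conjunct2, rule_format, OF EZ(1) ZU[OF that(1)], of "1/2"]
        that(2) by auto
    moreover have "(1/2) *\<^sub>R ?m + (1/2) *\<^sub>R Z \<omega> \<in> U"
      using f(2) that EZ(1) ZU unfolding strictly_convex_on_def convex_def by simp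
    ultimately show ?thesis using le[OF that(1)] fm by (auto simp: T_def)
  qed
  show ?thesis
  proof (cases "T = {}")
    \<comment> \<open>No midpoint can lie in the empty set, so \<open>Z\<close> equals its mean
      everywhere. Separation in the other case requires \<open>T\<close> to be nonempty.\<close>
    case True
    with mid show ?thesis by (intro AE_I2) blast
  next
    case False
    have "open T"
      using continuous_open_preimage[OF convex_on_continuous[OF U f(1)] U, of "{..<r}"]
      by (simp add: T_def Int_def vimage_def)
    have "convex T"
    proof (rule convexI)
      fix x y and u v :: real assume xy: "x \<in> T" "y \<in> T" "0 \<le> u" "0 \<le> v" "u + v = 1"
      have "f (u *\<^sub>R x + v *\<^sub>R y) \<le> u * f x + v * f y"
        using f(1) xy by (auto simp: convex_on_def T_def)
      also have "\<dots> < r"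
        using xy by (intro convex_bound_lt) (auto simp: T_def)
      finally show "u *\<^sub>R x + v *\<^sub>R y \<in> T"
        using xy f(1) by (auto simp: T_def convex_on_def convex_def)
    qed
    moreover have "{?m} \<inter> T = {}" using fm by (auto simp: T_def)
    ultimately obtain a b where ab: "a \<noteq> 0" "a \<bullet> ?m \<le> b" "\<forall>x\<in>T. b \<le> a \<bullet> x"
      using separating_hyperplane_sets[of "{?m}" T] False by auto
    have strict: "a \<bullet> ?m < a \<bullet> Z \<omega>" if "\<omega> \<in> space M" "Z \<omega> \<noteq> ?m" for \<omega>
    proof -
      have "b < a \<bullet> ((1/2) *\<^sub>R ?m + (1/2) *\<^sub>R Z \<omega>)"
        using ab \<open>open T\<close> mid[OF that] by (intro halfspace_ge_open_strict[of T]) auto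
      with ab(2) show ?thesis by (simp add: inner_add_right)
    qed
    have "expectation (\<lambda>\<omega>. a \<bullet> Z \<omega> - a \<bullet> ?m) = 0"
      using Z by (simp add: prob_space)
    moreover have "0 \<le> a \<bullet> Z \<omega> - a \<bullet> ?m" if "\<omega> \<in> space M" for \<omega>
      using strict[OF that] by (cases "Z \<omega> = ?m") auto
    ultimately have "AE \<omega> in M. a \<bullet> Z \<omega> - a \<bullet> ?m = 0"
      using Z by (subst (asm) integral_nonneg_eq_0_iff_AE) auto
    with AE_space show ?thesis
      by eventually_elim (use strict in force)
  qed
qed

section \<open>Mean vectors and power means\<close>

lemma integrable_Pair:
  fixes X :: "'a \<Rightarrow> 'b::{banach, second_countable_topology}"
    and Y :: "'a \<Rightarrow> 'c::{banach, second_countable_topology}"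
  assumes "integrable M X" "integrable M Y"
  shows "integrable M (\<lambda>\<omega>. (X \<omega>, Y \<omega>))"
proof -
  have "bounded_linear (\<lambda>x::'b. (x, 0::'c))" "bounded_linear (\<lambda>y::'c. (0::'b, y))"
    by (auto intro!: bounded_linear_Pair bounded_linear_ident bounded_linear_zero)
  then have "integrable M (\<lambda>\<omega>. (X \<omega>, 0) + (0, Y \<omega>))"
    using assms by (intro Bochner_Integration.integrable_add) (auto intro: integrable_bounded_linear)
  then show ?thesis by simp
qed

lemma integral_Pair:
  fixes X :: "'a \<Rightarrow> 'b::{banach, second_countable_topology}"
    and Y :: "'a \<Rightarrow> 'c::{banach, second_countable_topology}"
  assumes "integrable M X" "integrable M Y"
  shows "(LINT \<omega>|M. (X \<omega>, Y \<omega>)) = (integral\<^sup>L M X, integral\<^sup>L M Y)"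
  using integral_bounded_linear[OF bounded_linear_fst integrable_Pair[OF assms]]
    integral_bounded_linear[OF bounded_linear_snd integrable_Pair[OF assms]]
  by (simp add: prod_eq_iff)

lemma (in prob_space) expectation_pos:
  fixes X :: "'a \<Rightarrow> real"
  assumes "integrable M X" "\<And>\<omega>. \<omega> \<in> space M \<Longrightarrow> 0 < X \<omega>"
  shows "0 < expectation X"
  using expectation_less[of "\<lambda>\<omega>. - X \<omega>" 0] assms by simp

lemma (in prob_space) expectation_le_power_mean:
  fixes X :: "'a \<Rightarrow> real"
  assumes X: "integrable M X" "integrable M (\<lambda>\<omega>. X \<omega> ^ p)" and pos: "\<And>\<omega>. \<omega> \<in> space M \<Longrightarrow> 0 < X \<omega>"
    and p: "0 < p"
  shows "expectation X \<le> expectation (\<lambda>\<omega>. X \<omega> ^ p) powr (1 / real p)"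
proof -
  have cvx: "convex_on {0<..} (\<lambda>x::real. x ^ p)"
    by (cases "even p") (auto intro: convex_on_subset[OF convex_power_even] convex_on_subset[OF convex_power_odd])
  have "expectation X ^ p \<le> expectation (\<lambda>\<omega>. X \<omega> ^ p)"
    using pos by (intro jensens_inequality[where I = "{0<..}"] X cvx) auto
  then have "(expectation X ^ p) powr (1 / real p) \<le> expectation (\<lambda>\<omega>. X \<omega> ^ p) powr (1 / real p)"
    using expectation_pos[OF X(1) pos] by (intro powr_mono2) auto
  moreover have "(expectation X ^ p) powr (1 / real p) = expectation X"
    using expectation_pos[OF X(1) pos] p by (simp add: powr_powr flip: powr_realpow)
  ultimately show ?thesis by simp
qed

section \<open>Orlicz functions\<close>

text \<open>The passage goes through the corner \<open>(x', y)\<close>, changing one coordinate at a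
  time; at least one of the two moves is strict.\<close>

lemma Phi2_strict_antimono:
  assumes "\<phi> \<in> Phi2" "0 < x" "0 < y" "x \<le> x'" "y \<le> y'" "(x, y) \<noteq> (x', y')"
  shows "\<phi> (x', y') < \<phi> (x, y)"
proof -
  have 1: "\<phi> (b, s) < \<phi> (a, s)" "\<phi> (s, b) < \<phi> (s, a)" if "0 < a" "0 < s" "a < b" for a b s
    using \<open>\<phi> \<in> Phi2\<close> that by (simp_all add: Phi2_def)
  have "\<phi> (x', y) < \<phi> (x, y) \<or> x = x'" "\<phi> (x', y') < \<phi> (x', y) \<or> y = y'"
    using assms 1(1)[of x y x'] 1(2)[of y x' y'] by auto
  with assms(6) show ?thesis by auto
qed

lemma Phi2_antimono:
  assumes "\<phi> \<in> Phi2" "0 < x" "0 < y" "x \<le> x'" "y \<le> y'"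
  shows "\<phi> (x', y') \<le> \<phi> (x, y)"
  using Phi2_strict_antimono[OF assms] by (cases "(x, y) = (x', y')") auto

text \<open>On the line with first coordinate \<open>1\<close>, \<open>\<phi>\<close> decreases to
  its limit \<open>1\<close>. This bounds the Orlicz half width from above: a solution
  \<open>c\<close> of \<open>\<phi> (x / c, y / c) = 1\<close> must satisfy
  \<open>c < x\<close>.\<close>

lemma Phi2_gt_1:
  assumes \<phi>: "\<phi> \<in> Phi2" and "0 < x" "x \<le> 1" "0 < y"
  shows "1 < \<phi> (x, y)"
proof -
  have lim: "((\<lambda>y. \<phi> (1, y)) \<longlongrightarrow> 1) at_top" using \<phi> by (simp add: Phi2_def)
  \<comment> \<open>A limit yields only a weak inequality; taking it at \<open>y + 1\<close> leaves
    a strict decrease between \<open>y\<close> and \<open>y + 1\<close>.\<close>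
  have "1 \<le> \<phi> (1, y + 1)"
  proof (rule tendsto_upperbound[OF lim])
    show "\<forall>\<^sub>F z in at_top. \<phi> (1, z) \<le> \<phi> (1, y + 1)"
      using assms by (intro eventually_at_top_linorderI[of "y + 1"] Phi2_antimono[OF \<phi>]) auto
  qed simp
  also have "\<dots> < \<phi> (x, y)"
    using assms by (intro Phi2_strict_antimono) auto
  finally show ?thesis .
qed

lemma (in prob_space) Phi2_jensen:
  fixes X Y :: "'a \<Rightarrow> real"
  assumes \<phi>: "\<phi> \<in> Phi2" and p: "0 < p"
    and X: "integrable M X" "integrable M (\<lambda>\<omega>. X \<omega> ^ p)" "\<And>\<omega>. \<omega> \<in> space M \<Longrightarrow> 0 < X \<omega>"
    and Y: "integrable M Y" "integrable M (\<lambda>\<omega>. Y \<omega> ^ p)" "\<And>\<omega>. \<omega> \<in> space M \<Longrightarrow> 0 < Y \<omega>"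
    and eq: "\<And>\<omega>. \<omega> \<in> space M \<Longrightarrow> \<phi> (X \<omega>, Y \<omega>) = 1"
  defines "P \<equiv> \<phi> (expectation (\<lambda>\<omega>. X \<omega> ^ p) powr (1 / real p), expectation (\<lambda>\<omega>. Y \<omega> ^ p) powr (1 / real p))"
  shows "P \<le> 1"
    and "strictly_convex_on pos_quadrant \<phi> \<Longrightarrow> P = 1 \<Longrightarrow>
      AE \<omega> in M. X \<omega> = expectation X \<and> Y \<omega> = expectation Y"
proof -
  have op: "open pos_quadrant" by (intro open_Times) auto
  have cvx: "convex_on pos_quadrant \<phi>" using \<phi> by (simp add: Phi2_def)
  let ?Z = "\<lambda>\<omega>. (X \<omega>, Y \<omega>)"
  have EZ: "expectation ?Z = (expectation X, expectation Y)"
    by (rule integral_Pair) fact+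
  have pos: "0 < expectation X" "0 < expectation Y"
    using X Y by (auto intro: expectation_pos)
  have Z: "integrable M ?Z" by (rule integrable_Pair) fact+
  have "\<phi> (expectation ?Z) \<le> 1"
    using X Y eq EZ pos by (intro expectation_sublevel[OF Z op cvx]) auto
  moreover have P: "P \<le> \<phi> (expectation X, expectation Y)"
    unfolding P_def using \<phi> pos X Y p
    by (intro Phi2_antimono expectation_le_power_mean) auto
  ultimately show "P \<le> 1" by (simp add: EZ)
  assume sc: "strictly_convex_on pos_quadrant \<phi>" and "P = 1"
  \<comment> \<open>The mean vector is squeezed: \<open>P = 1\<close> is a lower bound for
    \<open>\<phi>\<close> there, which is what the equality case for sublevel sets asks for.\<close>
  with P have "1 \<le> \<phi> (expectation ?Z)" by (simp add: EZ)
  then have "AE \<omega> in M. ?Z \<omega> = expectation ?Z"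
    using X Y eq EZ pos by (intro strictly_convex_expectation_sublevel[OF Z op cvx sc]) auto
  then show "AE \<omega> in M. X \<omega> = expectation X \<and> Y \<omega> = expectation Y"
    by (simp add: EZ)
qed

text \<open>Enlarging the denominator shrinks both arguments and so strictly raises
  \<open>\<phi>\<close>.\<close>

lemma Phi2_solution_unique:
  assumes \<phi>: "\<phi> \<in> Phi2" and "0 < x" "0 < y" "0 < c" "0 < d"
    and "\<phi> (x / c, y / c) = 1" "\<phi> (x / d, y / d) = 1"
  shows "c = d"
proof -
  have "\<phi> (x / s, y / s) < \<phi> (x / t, y / t)" if "0 < s" "s < t" for s t
    using assms that by (intro Phi2_strict_antimono) (auto simp: frac_le divide_strict_left_mono)
  from this[of c d] this[of d c] assms show ?thesis by force
qed

text \<open>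
  The solution \<open>c\<close> is measurable because \<open>c \<le> r\<close> holds exactly where \<open>\<phi>(x/r, y/r) \<ge> 1\<close>.
\<close>

lemma Phi2_solution_measurable:
  fixes x y c :: "'a \<Rightarrow> real"
  assumes \<phi>: "\<phi> \<in> Phi2" and [measurable]: "x \<in> borel_measurable M" "y \<in> borel_measurable M"
    and pos: "\<And>u. u \<in> space M \<Longrightarrow> 0 < x u" "\<And>u. u \<in> space M \<Longrightarrow> 0 < y u" "\<And>u. u \<in> space M \<Longrightarrow> 0 < c u"
    and eq: "\<And>u. u \<in> space M \<Longrightarrow> \<phi> (x u / c u, y u / c u) = 1"
  shows "c \<in> borel_measurable M"
  unfolding borel_measurable_iff_le
proof
  fix r
  show "{u \<in> space M. c u \<le> r} \<in> sets M"
  proof (cases "0 < r")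
    case False
    then have "\<not> c u \<le> r" if "u \<in> space M" for u using pos(3)[OF that] by linarith
    then have "{u \<in> space M. c u \<le> r} = {}" by blast
    then show ?thesis by (simp only: sets.empty_sets)
  next
    case True
    have op: "open pos_quadrant" by (intro open_Times) auto
    have "convex_on pos_quadrant \<phi>" using \<phi> by (simp add: Phi2_def)
    \<comment> \<open>Convexity on an open set gives continuity there. Off the quadrant
      \<open>\<phi>\<close> is arbitrary, hence the restricted Borel space.\<close>
    then have "\<phi> \<in> borel_measurable (restrict_space borel pos_quadrant)"
      by (intro borel_measurable_continuous_on_restrict convex_on_continuous op)
    moreover have "(\<lambda>u. (x u / r, y u / r)) \<in> measurable M (restrict_space borel pos_quadrant)"
      using pos True by (intro measurable_restrict_space2) auto
    ultimately have [measurable]: "(\<lambda>u. \<phi> (x u / r, y u / r)) \<in> borel_measurable M"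
      by (rule measurable_compose[rotated])
    have "c u \<le> r \<longleftrightarrow> 1 \<le> \<phi> (x u / r, y u / r)" if u: "u \<in> space M" for u
    proof
      assume "c u \<le> r"
      then have "\<phi> (x u / c u, y u / c u) \<le> \<phi> (x u / r, y u / r)"
        using pos[OF u] True by (intro Phi2_antimono[OF \<phi>]) (auto simp: frac_le)
      then show "1 \<le> \<phi> (x u / r, y u / r)" using eq[OF u] by simp
    next
      assume ge: "1 \<le> \<phi> (x u / r, y u / r)"
      show "c u \<le> r"
      proof (rule ccontr)
        assume "\<not> c u \<le> r"
        then have "\<phi> (x u / r, y u / r) < \<phi> (x u / c u, y u / c u)"
          using pos[OF u] True by (intro Phi2_strict_antimono[OF \<phi>]) (auto simp: frac_le divide_strict_left_mono)
        then show False using ge eq[OF u] by simp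
      qed
    qed
    then have "{u \<in> space M. c u \<le> r} = {u \<in> space M. 1 \<le> \<phi> (x u / r, y u / r)}" by blast
    then show ?thesis by simp
  qed
qed

text \<open>The analytic content of the theorem, with the sphere replaced by any finite measure
  space of positive mass, and the half widths by bounded positive measurable functions.\<close>

lemma Phi2_power_integral:
  fixes x y c :: "'a \<Rightarrow> real"
  assumes "finite_measure M" and nonnull: "emeasure M (space M) \<noteq> 0"
    and \<phi>: "\<phi> \<in> Phi2" and p: "0 < p"
    and [measurable]: "x \<in> borel_measurable M" "y \<in> borel_measurable M"
    and pos: "\<And>u. u \<in> space M \<Longrightarrow> 0 < x u" "\<And>u. u \<in> space M \<Longrightarrow> 0 < y u" "\<And>u. u \<in> space M \<Longrightarrow> 0 < c u"
    and bound: "\<And>u. u \<in> space M \<Longrightarrow> x u \<le> B" "\<And>u. u \<in> space M \<Longrightarrow> y u \<le> B"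
    and eq: "\<And>u. u \<in> space M \<Longrightarrow> \<phi> (x u / c u, y u / c u) = 1"
  defines "W \<equiv> LINT u|M. c u ^ p"
  defines "P \<equiv> \<phi> (((LINT u|M. x u ^ p) / W) powr (1 / real p), ((LINT u|M. y u ^ p) / W) powr (1 / real p))"
  shows "0 < W" and "P \<le> 1"
    and "strictly_convex_on pos_quadrant \<phi> \<Longrightarrow> P = 1 \<Longrightarrow>
      \<exists>s>0. \<exists>t>0. AE u in M. x u / c u = s \<and> y u / c u = t"
proof -
  interpret finite_measure M by fact
  have c_meas[measurable]: "c \<in> borel_measurable M"
    by (rule Phi2_solution_measurable[OF \<phi> _ _ pos eq]) simp_all
  have c_less: "c u < x u" if u: "u \<in> space M" for u
    using Phi2_gt_1[OF \<phi>, of "x u / c u" "y u / c u"] pos[OF u] eq[OF u]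
    by (cases "c u < x u") auto
  have c_B: "c u \<le> B" if u: "u \<in> space M" for u
    using c_less[OF u] bound[OF u] by simp
  \<comment> \<open>One bound serves all later integrands: \<open>l = 0\<close> gives single powers,
    and \<open>k = 1\<close>, \<open>l = p - 1\<close> gives the mixed integrand of the first moment
    below.\<close>
  have int: "integrable M (\<lambda>u. f u ^ k * g u ^ l)"
    if [measurable]: "f \<in> borel_measurable M" "g \<in> borel_measurable M"
      and f: "\<And>u. u \<in> space M \<Longrightarrow> 0 < f u \<and> f u \<le> B" and g: "\<And>u. u \<in> space M \<Longrightarrow> 0 < g u \<and> g u \<le> B"
    for f g k l
  proof (rule integrable_const_bound[where B = "B ^ k * B ^ l"])
    show "AE u in M. norm (f u ^ k * g u ^ l) \<le> B ^ k * B ^ l"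
      using f g by (intro AE_I2) (fastforce simp: abs_mult intro!: mult_mono power_mono)
  qed simp
  have int_c: "integrable M (\<lambda>u. c u ^ p)" using int[of c c p 0] pos c_B by simp
  have "W \<noteq> 0"
  proof
    assume "W = 0"
    moreover have "AE u in M. 0 \<le> c u ^ p" using pos(3) by (intro AE_I2) (simp add: less_imp_le)
    ultimately have "AE u in M. c u ^ p = 0"
      unfolding W_def using integral_nonneg_eq_0_iff_AE[OF int_c] by blast
    with AE_space have "AE u in M. False"
      by eventually_elim (use pos(3) in force)
    with nonnull show False by (simp add: AE_iff_measurable[OF sets.top])
  qed
  moreover have "0 \<le> W" unfolding W_def using pos(3) by (intro integral_nonneg_AE AE_I2) (simp add: less_imp_le)
  ultimately show W: "0 < W" by simp
  \<comment> \<open>With this weight the factor \<open>c u ^ p\<close> cancels the denominator of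
    \<open>(f u / c u) ^ p\<close>, so that \<open>p\<close>-th moments become quotients of
    integrals over \<open>M\<close>.\<close>
  define w where "w u = c u ^ p / W" for u
  have [measurable]: "w \<in> borel_measurable M" unfolding w_def by simp
  have w_pos: "0 < w u" if "u \<in> space M" for u using W pos(3)[OF that] by (simp add: w_def)
  have AE_w: "AE u in M. 0 \<le> w u" using w_pos by (intro AE_I2) (simp add: less_imp_le)
  let ?N = "density M (\<lambda>u. ennreal (w u))"
  have "prob_space ?N"
  proof
    have "emeasure ?N (space ?N) = (\<integral>\<^sup>+u. ennreal (w u) \<partial>M)"
      by (simp add: emeasure_density cong: nn_integral_cong)
    also have "\<dots> = ennreal (LINT u|M. w u)"
      using int_c AE_w by (intro nn_integral_eq_integral) (auto simp: w_def[abs_def])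
    also have "(LINT u|M. w u) = 1" using W by (simp add: w_def W_def)
    finally show "emeasure ?N (space ?N) = 1" by simp
  qed
  then interpret N: prob_space ?N .
  have *: "integrable ?N (\<lambda>u. f u / c u) \<and> integrable ?N (\<lambda>u. (f u / c u) ^ p)
      \<and> N.expectation (\<lambda>u. (f u / c u) ^ p) = (LINT u|M. f u ^ p) / W"
    if f[measurable]: "f \<in> borel_measurable M" and fB: "\<And>u. u \<in> space M \<Longrightarrow> 0 < f u \<and> f u \<le> B" for f
  proof -
    have cp: "0 < c u \<and> c u \<le> B" if "u \<in> space M" for u using pos(3) c_B that by simp
    have cnz: "c u \<noteq> 0" if "u \<in> space M" for u using pos(3)[OF that] by simp
    \<comment> \<open>The quotient \<open>f u / c u\<close> may be unbounded, as \<open>c\<close>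
      has no positive lower bound. Since \<open>p\<close> is at least \<open>1\<close>, the weight
      absorbs the denominator and leaves a bounded function.\<close>
    have "integrable M (\<lambda>u. w u * (f u / c u)) \<longleftrightarrow> integrable M (\<lambda>u. (f u ^ 1 * c u ^ (p - 1)) / W)"
      using p cnz by (intro Bochner_Integration.integrable_cong) (auto simp: w_def power_eq_if field_simps)
    moreover have "integrable M (\<lambda>u. (f u ^ 1 * c u ^ (p - 1)) / W)"
      using int[OF f c_meas fB cp, of 1 "p - 1"] by simp
    moreover have e: "w u * (f u / c u) ^ p = f u ^ p / W" if "u \<in> space M" for u
      using cnz[OF that] by (simp add: w_def power_divide)
    have "integrable M (\<lambda>u. w u * (f u / c u) ^ p) \<longleftrightarrow> integrable M (\<lambda>u. f u ^ p / W)"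
      by (intro Bochner_Integration.integrable_cong e) simp
    moreover have "integrable M (\<lambda>u. f u ^ p / W)" using int[OF f f fB fB, of p 0] by simp
    moreover have "(LINT u|M. w u * (f u / c u) ^ p) = (LINT u|M. f u ^ p / W)"
      by (intro Bochner_Integration.integral_cong e) simp
    ultimately show ?thesis
      using AE_w by (simp add: integrable_density integral_density)
  qed
  have X: "integrable ?N (\<lambda>u. x u / c u)" "integrable ?N (\<lambda>u. (x u / c u) ^ p)"
      "N.expectation (\<lambda>u. (x u / c u) ^ p) = (LINT u|M. x u ^ p) / W"
    using *[of x] pos bound by auto
  have Y: "integrable ?N (\<lambda>u. y u / c u)" "integrable ?N (\<lambda>u. (y u / c u) ^ p)"
      "N.expectation (\<lambda>u. (y u / c u) ^ p) = (LINT u|M. y u ^ p) / W"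
    using *[of y] pos bound by auto
  have quot: "0 < x u / c u" "0 < y u / c u" if "u \<in> space ?N" for u
    using that pos by auto
  have eq': "\<phi> (x u / c u, y u / c u) = 1" if "u \<in> space ?N" for u using that eq by simp
  note J = N.Phi2_jensen[OF \<phi> p X(1,2) quot(1) Y(1,2) quot(2) eq', unfolded X(3) Y(3), folded P_def]
  show "P \<le> 1" by (rule J(1))
  assume "strictly_convex_on pos_quadrant \<phi>" "P = 1"
  then have "AE u in ?N. x u / c u = N.expectation (\<lambda>u. x u / c u) \<and> y u / c u = N.expectation (\<lambda>u. y u / c u)"
    by (intro J(2))
  \<comment> \<open>The weight is positive on the whole space, so null sets of the weighted measure
    are null for \<open>M\<close>.\<close>
  then have "AE u in M. 0 < w u \<longrightarrow> x u / c u = N.expectation (\<lambda>u. x u / c u) \<and> y u / c u = N.expectation (\<lambda>u. y u / c u)"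
    by (subst (asm) AE_density) (simp_all only: ennreal_0 ennreal_less_zero_iff, simp)
  with AE_space have "AE u in M. x u / c u = N.expectation (\<lambda>u. x u / c u) \<and> y u / c u = N.expectation (\<lambda>u. y u / c u)"
    by eventually_elim (use w_pos in blast)
  moreover have "0 < N.expectation (\<lambda>u. x u / c u)" "0 < N.expectation (\<lambda>u. y u / c u)"
    using X Y quot by (auto intro: N.expectation_pos)
  ultimately show "\<exists>s>0. \<exists>t>0. AE u in M. x u / c u = s \<and> y u / c u = t" by blast
qed

section \<open>Support functions and the sphere\<close>

lemma support_fun_ge:
  fixes K :: "(real^'n) set"
  assumes "compact K" "y \<in> K"
  shows "x \<bullet> y \<le> support_fun K x"
  using support_fun_is_max[of K x] assms by fastforce

text \<open>A maximum of linear functions is convex, and a finite convex function on the whole space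
  is continuous.\<close>

lemma continuous_on_support_fun:
  fixes K :: "(real^'n) set"
  assumes "compact K" "K \<noteq> {}"
  shows "continuous_on UNIV (support_fun K)"
proof (rule convex_on_continuous)
  show "convex_on UNIV (support_fun K)"
  proof (rule convex_onI)
    fix t :: real and x y :: "real^'n" assume t: "0 < t" "t < 1"
    obtain z where z: "z \<in> K" "support_fun K ((1 - t) *\<^sub>R x + t *\<^sub>R y) = ((1 - t) *\<^sub>R x + t *\<^sub>R y) \<bullet> z"
      using support_fun_is_max[OF assms] by blast
    have "((1 - t) *\<^sub>R x + t *\<^sub>R y) \<bullet> z = (1 - t) * (x \<bullet> z) + t * (y \<bullet> z)"
      by (simp add: inner_add_left)
    also have "\<dots> \<le> (1 - t) * support_fun K x + t * support_fun K y"
      using t z assms by (intro add_mono mult_left_mono support_fun_ge) auto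
    finally show "support_fun K ((1 - t) *\<^sub>R x + t *\<^sub>R y) \<le> (1 - t) * support_fun K x + t * support_fun K y"
      using z by simp
  qed simp
qed simp

lemma support_fun_pos:
  fixes K :: "(real^'n) set"
  assumes "K \<in> convex_bodies_o" "u \<noteq> 0"
  shows "0 < support_fun K u"
proof -
  obtain e where e: "0 < e" "cball 0 e \<subseteq> K"
    using assms by (auto simp: convex_bodies_o_def mem_interior_cball)
  have "(e / norm u) *\<^sub>R u \<in> K" using e assms by (intro subsetD[OF e(2)]) simp
  then have "u \<bullet> ((e / norm u) *\<^sub>R u) \<le> support_fun K u"
    using assms by (intro support_fun_ge) (auto simp: convex_bodies_o_def)
  moreover have "0 < u \<bullet> ((e / norm u) *\<^sub>R u)" using e assms by simp
  ultimately show ?thesis by linarith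
qed

lemma continuous_on_half_width:
  assumes "K \<in> convex_bodies_o"
  shows "continuous_on S (half_width K)"
proof -
  have K: "compact K" "K \<noteq> {}" using assms interior_subset by (auto simp: convex_bodies_o_def)
  have "continuous_on UNIV (\<lambda>x. support_fun K (- x))"
    by (intro continuous_on_compose2[OF continuous_on_support_fun[OF K]] continuous_intros) auto
  then show ?thesis
    unfolding half_width_def[abs_def]
    using continuous_on_subset[OF continuous_on_support_fun[OF K]]
    by (auto intro!: continuous_intros intro: continuous_on_subset)
qed

lemma half_width_pos:
  assumes "K \<in> convex_bodies_o" "u \<in> sphere 0 1"
  shows "0 < half_width K u"
  using support_fun_pos[OF assms(1), of u] support_fun_pos[OF assms(1), of "- u"] assms(2)
  by (force simp: half_width_def)

lemma half_width_measurable: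
  assumes "K \<in> convex_bodies_o"
  shows "half_width K \<in> borel_measurable sphere_measure"
  using borel_measurable_continuous_on_restrict[OF continuous_on_half_width[OF assms]]
  by (simp add: measurable_cong_sets[OF sets_sphere_measure refl])

section \<open>Finiteness and full support of the sphere measure\<close>

lemma finite_sphere_measure: "finite_measure (sphere_measure :: (real^'n) measure)"
proof
  let ?C = "{t *\<^sub>R u | t u. 0 < t \<and> t \<le> 1 \<and> u \<in> sphere 0 1} :: (real^'n) set"
  have "emeasure lborel ?C \<le> emeasure lborel (cball 0 1 :: (real^'n) set)"
    by (intro emeasure_mono) auto
  also have "\<dots> < \<infinity>" by (rule emeasure_bounded_finite) simp
  finally have "of_nat CARD('n) * emeasure lborel ?C < \<infinity>"
    by (simp add: ennreal_mult_less_top of_nat_less_top)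
  then show "emeasure (sphere_measure :: (real^'n) measure) (space sphere_measure) \<noteq> \<infinity>"
    by (simp add: space_sphere_measure emeasure_sphere_measure)
qed

text \<open>The cone over a nonempty relatively open part of the sphere contains a nonempty open
  set, so it has positive volume.\<close>

lemma sphere_measure_open_pos:
  fixes A :: "(real^'n) set"
  assumes "openin (top_of_set (sphere 0 1)) A" "A \<noteq> {}"
  shows "emeasure sphere_measure A \<noteq> 0"
proof -
  obtain T where T: "open T" "A = sphere 0 1 \<inter> T" using assms by (auto simp: openin_open)
  \<comment> \<open>The infinite open cone over \<open>A\<close>, without its apex.\<close>
  define C where "C = (- {0 :: real^'n}) \<inter> (\<lambda>x. x /\<^sub>R norm x) -` T"
  have "open C"
    unfolding C_def by (rule continuous_open_preimage) (auto intro!: continuous_intros T)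
  then have C: "open (ball 0 1 \<inter> C)" "cball 0 1 \<inter> C \<in> sets borel" by auto
  obtain a where "a \<in> A" using assms by blast
  \<comment> \<open>Halving moves the unit vector \<open>a\<close> into the open ball, where the
    truncated cone is open.\<close>
  then have "(1/2) *\<^sub>R a \<in> ball 0 1 \<inter> C" using T by (auto simp: C_def)
  then have "\<not> negligible (ball 0 1 \<inter> C)"
    using open_not_negligible[OF C(1)] by blast
  then have "emeasure lborel (ball 0 1 \<inter> C) \<noteq> 0"
    using C(1) by (simp add: negligible_iff_emeasure0 emeasure_completion)
  moreover have "emeasure lborel (ball 0 1 \<inter> C) \<le> emeasure lborel (cball 0 1 \<inter> C)"
    using C(2) by (intro emeasure_mono) auto
  ultimately have "emeasure lborel (cball 0 1 \<inter> C) \<noteq> 0" by (metis le_zero_eq)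
  moreover have "{t *\<^sub>R u | t u. 0 < t \<and> t \<le> 1 \<and> u \<in> A} = cball 0 1 \<inter> C" (is "?L = ?R")
  proof
    show "?L \<subseteq> ?R" using T by (auto simp: C_def)
    show "?R \<subseteq> ?L"
    proof
      fix x assume "x \<in> ?R"
      then have "x = norm x *\<^sub>R (x /\<^sub>R norm x)" "0 < norm x" "norm x \<le> 1" "x /\<^sub>R norm x \<in> A"
        using T by (auto simp: C_def)
      then show "x \<in> ?L" by blast
    qed
  qed
  moreover have "A \<in> sets borel" "A \<subseteq> sphere 0 1" using T by auto
  ultimately show ?thesis by (simp add: emeasure_sphere_measure)
qed

text \<open>The set where two continuous functions differ is relatively open; being null, it is
  empty by \<open>sphere_measure_open_pos\<close>.\<close>

lemma AE_sphere_measure_imp: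
  fixes f g :: "real^'n \<Rightarrow> real"
  assumes "continuous_on (sphere 0 1) f" "continuous_on (sphere 0 1) g"
    and AE: "AE u in sphere_measure. f u = g u" and u: "u \<in> sphere 0 1"
  shows "f u = g u"
proof (rule ccontr)
  assume ne: "f u \<noteq> g u"
  let ?A = "sphere 0 1 \<inter> (\<lambda>u. f u - g u) -` (- {0})"
  have op: "openin (top_of_set (sphere 0 1)) ?A"
    using assms by (intro continuous_openin_preimage_gen continuous_intros) auto
  then obtain T where "open T" "?A = sphere 0 1 \<inter> T" by (auto simp: openin_open)
  then have "?A \<in> sets sphere_measure"
    by (auto simp: sets_sphere_measure sets_restrict_space)
  moreover have "?A = {u \<in> space sphere_measure. \<not> f u = g u}"
    by (auto simp: space_sphere_measure)
  ultimately have "emeasure sphere_measure ?A = 0"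
    using AE by (simp add: AE_iff_measurable)
  with sphere_measure_open_pos[OF op] have "?A = {}" by blast
  moreover have "u \<in> ?A" using ne u by simp
  ultimately show False by blast
qed

section \<open>The half width of the Orlicz sum and the final inequality\<close>

lemma orlicz_half_width_solution:
  assumes K: "K \<in> convex_bodies_o" and L: "L \<in> convex_bodies_o" and \<phi>: "\<phi> \<in> Phi2"
    and "orlicz_sum_defined \<phi> K L" and u: "u \<in> sphere 0 1"
  shows "is_orlicz_half_width \<phi> K L u (orlicz_half_width \<phi> K L u)"
proof -
  obtain c where c: "is_orlicz_half_width \<phi> K L u c"
    using assms unfolding orlicz_sum_defined_def by blast
  show ?thesis
    unfolding orlicz_half_width_def
  \<comment> \<open>The description denotes a solution: one exists by assumption, and
    \<open>Phi2_solution_unique\<close> at the positive half widths excludes a second.\<close>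
  proof (rule theI[of _ c])
    fix d assume "is_orlicz_half_width \<phi> K L u d"
    with c show "d = c"
      using half_width_pos[OF K u] half_width_pos[OF L u]
      by (auto simp: is_orlicz_half_width_def intro: Phi2_solution_unique[OF \<phi>])
  qed fact
qed

theorem theorem6p2:
  fixes K L :: "(real^'n) set" and i :: nat and \<phi> :: "real \<times> real \<Rightarrow> real"
  assumes "K \<in> convex_bodies_o" and "L \<in> convex_bodies_o"
    and "i < CARD('n)"
    and "\<phi> \<in> Phi2"
    and "orlicz_sum_defined \<phi> K L"
  shows "1 \<ge> \<phi> ((width_integral i K / orlicz_width_integral i \<phi> K L) powr (1 / real (CARD('n) - i)),
                 (width_integral i L / orlicz_width_integral i \<phi> K L) powr (1 / real (CARD('n) - i)))
    \<and> (strictly_convex_on pos_quadrant \<phi> \<longrightarrow>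
        (1 = \<phi> ((width_integral i K / orlicz_width_integral i \<phi> K L) powr (1 / real (CARD('n) - i)),
                (width_integral i L / orlicz_width_integral i \<phi> K L) powr (1 / real (CARD('n) - i)))
         \<longleftrightarrow> similar_width K L))"
proof -
  note K = assms(1) and L = assms(2) and \<phi> = assms(4)
  let ?x = "half_width K" and ?y = "half_width L" and ?c = "orlicz_half_width \<phi> K L"
  let ?S = "sphere_measure :: (real^'n) measure"
  define p where "p = CARD('n) - i"
  have p: "0 < p" using assms(3) by (simp add: p_def)
  have sol: "0 < ?c u" "\<phi> (?x u / ?c u, ?y u / ?c u) = 1" if "u \<in> sphere 0 1" for u
    using orlicz_half_width_solution[OF K L \<phi> assms(5) that] by (auto simp: is_orlicz_half_width_def)
  have "\<exists>B. \<forall>u\<in>sphere 0 1. half_width M u \<le> B" if "M \<in> convex_bodies_o" for M :: "(real^'n) set"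
    using compact_continuous_image[OF continuous_on_half_width[OF that] compact_sphere[of 0 1]]
    by (auto dest!: compact_imp_bounded bounded_imp_bdd_above simp: bdd_above_def)
  then obtain B1 B2 where "\<And>u. u \<in> sphere 0 1 \<Longrightarrow> ?x u \<le> B1" "\<And>u. u \<in> sphere 0 1 \<Longrightarrow> ?y u \<le> B2"
    using K L by meson
  then have bound: "?x u \<le> max B1 B2" "?y u \<le> max B1 B2" if "u \<in> sphere 0 1" for u
    using that by (auto intro: max.coboundedI1 max.coboundedI2)
  have nonnull: "emeasure ?S (space ?S) \<noteq> 0"
    unfolding space_sphere_measure by (rule sphere_measure_open_pos) auto
  let ?W = "LINT u|?S. ?c u ^ p"
  \<comment> \<open>The normalising factors \<open>1 / n\<close> cancel.\<close>
  have ratio: "width_integral i M / orlicz_width_integral i \<phi> K L = (LINT u|?S. half_width M u ^ p) / ?W" for M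
    by (simp add: width_integral_def orlicz_width_integral_def width_integral_of_def p_def)
  define P where "P = \<phi> (((LINT u|?S. ?x u ^ p) / ?W) powr (1 / real p), ((LINT u|?S. ?y u ^ p) / ?W) powr (1 / real p))"
  note power_integral = Phi2_power_integral[OF finite_sphere_measure nonnull \<phi> p half_width_measurable[OF K]
      half_width_measurable[OF L], of ?c "max B1 B2", unfolded space_sphere_measure,
      OF half_width_pos[OF K] half_width_pos[OF L] sol(1) bound sol(2), folded P_def]
  have W: "0 < ?W" by (rule power_integral(1))
  have "P \<le> 1" by (rule power_integral(2))
  moreover have "P = 1 \<longleftrightarrow> similar_width K L" if sc: "strictly_convex_on pos_quadrant \<phi>"
  proof
    assume "P = 1"
    have "\<exists>s>0. \<exists>t>0. AE u in ?S. ?x u / ?c u = s \<and> ?y u / ?c u = t"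
      by (rule power_integral(3)) (assumption | rule sc \<open>P = 1\<close>)+
    then obtain s t where st: "s > 0" "t > 0" "AE u in ?S. ?x u / ?c u = s \<and> ?y u / ?c u = t"
      by blast
    \<comment> \<open>Eliminating \<open>?c\<close> leaves a relation between the two half widths,
      whose continuity lets it pass from almost every direction to every direction.\<close>
    have "AE u in ?S. ?x u = (s / t) * ?y u"
      using st(3) AE_space
    proof eventually_elim
      case (elim u)
      then show ?case using sol(1)[of u] st(1,2) by (auto simp: space_sphere_measure field_simps)
    qed
    then have "?x u = (s / t) * ?y u" if "u \<in> sphere 0 1" for u
      using that by (intro AE_sphere_measure_imp[of ?x "\<lambda>u. (s / t) * ?y u"] continuous_intros continuous_on_half_width K L)
    then show "similar_width K L"
      using st by (auto simp: similar_width_def intro!: exI[of _ "s / t"])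
  next
    assume "similar_width K L"
    then obtain k where k: "k > 0" "\<And>u. u \<in> sphere 0 1 \<Longrightarrow> ?x u = k * ?y u"
      by (auto simp: similar_width_def)
    \<comment> \<open>Any unit vector would do: it only fixes a number \<open>t\<close> solving
      \<open>\<phi> (k * t, t) = 1\<close>, an equation free of the direction.\<close>
    define e :: "real^'n" where "e = axis undefined 1"
    have e: "e \<in> sphere 0 1" by (simp add: e_def)
    define t where "t = ?y e / ?c e"
    have t: "t > 0" "\<phi> (k * t, t) = 1"
      using half_width_pos[OF L e] sol[OF e] k(2)[OF e] by (auto simp: t_def)
    have ct: "?y u = t * ?c u" "?x u = (k * t) * ?c u" if u: "u \<in> sphere 0 1" for u
    proof -
      \<comment> \<open>With \<open>?x u = k * ?y u\<close>, the candidate \<open>?y u / t\<close>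
        has arguments \<open>(k * t, t)\<close> in every direction. By uniqueness it is
        \<open>?c u\<close>, so both half widths are constant multiples of
        \<open>?c\<close>.\<close>
      have "\<phi> (?x u / (?y u / t), ?y u / (?y u / t)) = 1"
        using t half_width_pos[OF L u] k(2)[OF u] by simp
      then have "?c u = ?y u / t"
        using half_width_pos[OF L u] t(1)
        by (intro Phi2_solution_unique[OF \<phi> half_width_pos[OF K u] half_width_pos[OF L u] sol(1)[OF u] _ sol(2)[OF u]]
            divide_pos_pos)
      then show "?y u = t * ?c u" "?x u = (k * t) * ?c u" using t(1) k(2)[OF u] by simp_all
    qed
    have "(LINT u|?S. ?x u ^ p) = (LINT u|?S. (k * t) ^ p * ?c u ^ p)"
      by (intro Bochner_Integration.integral_cong) (auto simp: space_sphere_measure ct(2) power_mult_distrib)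
    then have x: "(LINT u|?S. ?x u ^ p) / ?W = (k * t) ^ p" using W by simp
    have "(LINT u|?S. ?y u ^ p) = (LINT u|?S. t ^ p * ?c u ^ p)"
      by (intro Bochner_Integration.integral_cong) (auto simp: space_sphere_measure ct(1) power_mult_distrib)
    then have y: "(LINT u|?S. ?y u ^ p) / ?W = t ^ p" using W by simp
    have root: "(r ^ p) powr (1 / real p) = r" if "r > 0" for r :: real
      using that p by (simp add: powr_powr flip: powr_realpow)
    have "0 < k * t" using k(1) t(1) by simp
    then show "P = 1"
      unfolding P_def x y root[OF \<open>0 < k * t\<close>] root[OF t(1)] by (simp only: t(2))
  qed
  ultimately show ?thesis
    unfolding ratio p_def[symmetric] P_def[symmetric] by (auto dest: sym)
qed

end
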